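(* Let $X$ be a continuum and let $f,g\colon X\to X$ be onto maps, neither of which is a homeomorphism, such that $f\neq g$. Let $(\lambda_i),(\rho_i)$ be the (finite or infinite) sequences produced from $f,g$ by the Euclidean-type algorithm described in the context. Then $f$ and $g$ are kin if and only if $f$ and $g$ commute and there is $N\in\mathbb{N}$ such that $\lambda_i,\rho_i$ are well-defined for all $1\le i\le N$, and $\lambda_N\circ\rho_N^{-1}$ is a homeomorphism. Moreover, $f$ and $g$ are cousins if and only if $f$ and $g$ commute and there is $N\in\mathbb{N}$ such that $\lambda_i,\rho_i$ are well-defined for all $1\le i\le N$, and $\lambda_N=\rho_N$.
   Context: A continuum is a compact, connected metric space. A map is a continuous function; $\mathbb{N}=\{1,2,\ldots\}$; powers denote iterates. Maps $f,g\colon X\to X$ commute if $f\circ g=g\circ f$. Kin and cousins: maps $f,g\colon X\to X$ are kin if there exist a map $\varphi\colon X\to X$, a homeomorphism $h\colon X\to X$ which commutes with $\varphi$, integers $a,b\ge 0$ and $n,m\in\mathbb{N}$ such that $f=h^a\circ\varphi^n$ and $g=h^b\circ\varphi^m$. They are cousins if there exist a map $\varphi\colon X\to X$ and $n,m\in\mathbb{N}$ such that $f=\varphi^n$ and $g=\varphi^m$. Set-valued compositions: for an onto map $g$, $g^{-1}(x)=\{y\in X: g(y)=x\}$, and $f\circ g^{-1}$ denotes the set-valued function $x\mapsto f(g^{-1}(x))$. If $f(g^{-1}(x))$ is a single point for every $x$, then $f\circ g^{-1}$ is identified with the function $X\to X$ taking those values; $f\circ g^{-1}$ is then said to be a map (it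 is continuous), and it is said to be a homeomorphism if in addition this function is a homeomorphism. Similarly $g^{-1}\circ g(x)=\{y: g(y)=g(x)\}$. Relation $\succ$: for onto maps $f,g\colon X\to X$ write $f\succ g$ if $g^{-1}\circ g(x)\subseteq f^{-1}\circ f(x)$ for all $x\in X$ and there is $x\in X$ with $g^{-1}\circ g(x)\neq f^{-1}\circ f(x)$. (Equivalently, $f\circ g^{-1}$ is a map which is not a homeomorphism.) Algorithm: given commuting onto non-homeomorphisms $f,g\colon X\to X$, set $\lambda_1=f$, $\rho_1=g$. For every $i\in\mathbb{N}$ such that $\lambda_i,\rho_i$ are defined and $\lambda_i\succ\rho_i$ or $\rho_i\succ\lambda_i$: if $\lambda_i\succ\rho_i$, set $\lambda_{i+1}=\lambda_i\circ\rho_i^{-1}$ and $\rho_{i+1}=\rho_i$; if $\rho_i\succ\lambda_i$, set $\lambda_{i+1}=\lambda_i$ and $\rho_{i+1}=\rho_i\circ\lambda_i^{-1}$. If neither $\lambda_i\succ\rho_i$ nor $\rho_i\succ\lambda_i$, then $\lambda_k,\rho_k$ are not defined for any $k>i$. *)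

theory Defs
  imports "HOL-Analysis.Analysis"
begin

definition is_homeo :: "('a::topological_space \<Rightarrow> 'a) \<Rightarrow> bool"
  where "is_homeo h \<longleftrightarrow> (\<exists>k. homeomorphism UNIV UNIV h k)"

definition commuting :: "('a \<Rightarrow> 'a) \<Rightarrow> ('a \<Rightarrow> 'a) \<Rightarrow> bool"
  where "commuting f g \<longleftrightarrow> f \<circ> g = g \<circ> f"

definition kin :: "('a::topological_space \<Rightarrow> 'a) \<Rightarrow> ('a \<Rightarrow> 'a) \<Rightarrow> bool"
  where "kin f g \<longleftrightarrow>
    (\<exists>\<phi> h. \<exists>(a::nat) (b::nat) (n::nat) (m::nat).
       continuous_on UNIV \<phi> \<and> is_homeo h \<and> commuting h \<phi> \<and> n \<ge> 1 \<and> m \<ge> 1 \<and>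
       f = (h ^^ a) \<circ> (\<phi> ^^ n) \<and> g = (h ^^ b) \<circ> (\<phi> ^^ m))"

definition cousins :: "('a::topological_space \<Rightarrow> 'a) \<Rightarrow> ('a \<Rightarrow> 'a) \<Rightarrow> bool"
  where "cousins f g \<longleftrightarrow>
    (\<exists>\<phi>. \<exists>(n::nat) (m::nat).
       continuous_on UNIV \<phi> \<and> n \<ge> 1 \<and> m \<ge> 1 \<and> f = \<phi> ^^ n \<and> g = \<phi> ^^ m)"

text \<open>The set-valued function \<open>f \<circ> g\<^sup>-\<^sup>1\<close>.\<close>

definition comp_inv :: "('a \<Rightarrow> 'b) \<Rightarrow> ('a \<Rightarrow> 'c) \<Rightarrow> 'c \<Rightarrow> 'b set"
  where "comp_inv f g x = f ` (g -` {x})"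

definition pointwise_singleton :: "('a \<Rightarrow> 'b set) \<Rightarrow> bool"
  where "pointwise_singleton F \<longleftrightarrow> (\<forall>x. is_singleton (F x))"

text \<open>The function with which a set-valued function all of whose values are singletons is
  identified; meaningful only under \<^const>\<open>pointwise_singleton\<close>.\<close>

definition as_fun :: "('a \<Rightarrow> 'b set) \<Rightarrow> 'a \<Rightarrow> 'b"
  where "as_fun F x = the_elem (F x)"

definition sv_homeo :: "('a::topological_space \<Rightarrow> 'a set) \<Rightarrow> bool"
  where "sv_homeo F \<longleftrightarrow> pointwise_singleton F \<and> is_homeo (as_fun F)"

text \<open>\<open>inv_comp g x\<close> is \<open>g\<^sup>-\<^sup>1 \<circ> g (x)\<close>, the fibre of \<open>g\<close> through \<open>x\<close>.\<close>

definition inv_comp :: "('a \<Rightarrow> 'b) \<Rightarrow> 'a \<Rightarrow> 'a set"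
  where "inv_comp g x = {y. g y = g x}"

definition succ_rel :: "('a \<Rightarrow> 'b) \<Rightarrow> ('a \<Rightarrow> 'c) \<Rightarrow> bool"  (infix \<open>\<succ>\<close> 50)
  where "f \<succ> g \<longleftrightarrow>
    (\<forall>x. inv_comp g x \<subseteq> inv_comp f x) \<and> (\<exists>x. inv_comp g x \<noteq> inv_comp f x)"

text \<open>One step of the algorithm. The conditions \<open>l \<succ> r\<close> and \<open>r \<succ> l\<close> exclude each other, and
  each makes the corresponding set-valued composition of onto maps pointwise a singleton.\<close>

definition euclid_step :: "('a \<Rightarrow> 'a) \<times> ('a \<Rightarrow> 'a) \<Rightarrow> (('a \<Rightarrow> 'a) \<times> ('a \<Rightarrow> 'a)) option"
  where "euclid_step = (\<lambda>(l, r).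
    if l \<succ> r then Some (as_fun (comp_inv l r), r)
    else if r \<succ> l then Some (l, as_fun (comp_inv r l))
    else None)"

text \<open>Indices start at 1; the value at index 0 is a dummy.\<close>

fun euclid_seq ::
  "('a \<Rightarrow> 'a) \<Rightarrow> ('a \<Rightarrow> 'a) \<Rightarrow> nat \<Rightarrow> (('a \<Rightarrow> 'a) \<times> ('a \<Rightarrow> 'a)) option"
  where
    "euclid_seq f g 0 = None"
  | "euclid_seq f g (Suc 0) = Some (f, g)"
  | "euclid_seq f g (Suc (Suc i)) = Option.bind (euclid_seq f g (Suc i)) euclid_step"

definition euclid_defined :: "('a \<Rightarrow> 'a) \<Rightarrow> ('a \<Rightarrow> 'a) \<Rightarrow> nat \<Rightarrow> bool"
  where "euclid_defined f g i \<longleftrightarrow> euclid_seq f g i \<noteq> None"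

text \<open>The maps \<open>\<lambda>\<^sub>i\<close> and \<open>\<rho>\<^sub>i\<close>; meaningful only under \<^const>\<open>euclid_defined\<close>.\<close>

definition euclid_lam :: "('a \<Rightarrow> 'a) \<Rightarrow> ('a \<Rightarrow> 'a) \<Rightarrow> nat \<Rightarrow> 'a \<Rightarrow> 'a"
  where "euclid_lam f g i = fst (the (euclid_seq f g i))"

definition euclid_rho :: "('a \<Rightarrow> 'a) \<Rightarrow> ('a \<Rightarrow> 'a) \<Rightarrow> nat \<Rightarrow> 'a \<Rightarrow> 'a"
  where "euclid_rho f g i = snd (the (euclid_seq f g i))"

end

theory Submission
  imports Defs
begin

text \<open>
  For onto maps, \<open>l \<succ> r\<close> says that \<open>l\<close> factors as \<open>\<mu> \<circ> r\<close> with \<open>\<mu>\<close> not injective, and the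
  factor \<open>\<mu>\<close> is then \<open>l \<circ> r\<^sup>-\<^sup>1\<close> (\<open>euclid_step_iff\<close>). A step of the algorithm therefore replaces
  \<open>\<mu> \<circ> r\<close> by \<open>\<mu>\<close>, and the procedure is the subtractive Euclidean algorithm
  written multiplicatively.

  If \<open>f = h\<^sup>a \<circ> \<phi>\<^sup>n\<close> and \<open>g = h\<^sup>b \<circ> \<phi>\<^sup>m\<close>, then, up to homeomorphisms that commute with \<open>\<phi>\<close>, the pairs
  produced are pairs of powers of \<open>\<phi>\<close>. As \<open>f\<close> is not a homeomorphism and the space is compact,
  \<open>\<phi>\<close> is not injective, so the entry with the larger exponent is in the relation \<open>\<succ>\<close> to the other
  entry, and the algorithm acts on the exponents exactly as subtraction does. It
  reaches equal exponents, and there the two maps differ by a homeomorphism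
  (\<open>euclid_reaches_equal_exponents\<close>).

  Conversely, each step can be undone by one composition, so \<open>f\<close> and \<open>g\<close> are words in
  \<open>\<lambda>\<^sub>N\<close> and \<open>\<rho>\<^sub>N\<close> (\<open>euclid_seq_generates\<close>). If \<open>\<lambda>\<^sub>N = h \<circ> \<rho>\<^sub>N\<close>, they are words in \<open>h\<close> and
  \<open>\<phi> = \<rho>\<^sub>N\<close>. Commutation and continuity pass from a pair to the next one
  (\<open>euclid_seq_invariant\<close>), hence \<open>h\<close> commutes with \<open>\<phi>\<close> and the words can be sorted.

  The claim about cousins is the same argument with only the identity allowed as a
  homeomorphism. For this reason the forward half is proved for an arbitrary set of bijections
  commuting with \<open>\<phi>\<close> and closed under quotients, and the backward half for
  an arbitrary set of maps closed under composition.
\<close>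

section \<open>Factorization through an onto map\<close>

lemma comp_inv_factor:
  assumes "surj r"
  shows "comp_inv (\<mu> \<circ> r) r x = {\<mu> x}"
proof -
  obtain y where "r y = x" using assms by (metis surjD)
  then show ?thesis unfolding comp_inv_def by auto
qed

lemma as_fun_comp_inv_factor:
  assumes "surj r"
  shows "as_fun (comp_inv (\<mu> \<circ> r) r) = \<mu>"
  by (rule ext) (simp add: as_fun_def comp_inv_factor[OF assms] del: comp_apply)

lemma pointwise_singleton_factor:
  assumes "surj r"
  shows "pointwise_singleton (comp_inv (\<mu> \<circ> r) r)"
  by (simp add: pointwise_singleton_def comp_inv_factor[OF assms] is_singleton_def)

lemma factor_of_pointwise_singleton:
  assumes "pointwise_singleton (comp_inv l r)"
  shows "l = as_fun (comp_inv l r) \<circ> r"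
proof
  fix x
  obtain c where c: "comp_inv l r (r x) = {c}"
    using assms unfolding pointwise_singleton_def is_singleton_def by blast
  moreover have "l x \<in> comp_inv l r (r x)" unfolding comp_inv_def by auto
  ultimately show "l x = (as_fun (comp_inv l r) \<circ> r) x" by (simp add: as_fun_def)
qed

lemma succ_rel_iff_factor:
  assumes "surj r"
  shows "l \<succ> r \<longleftrightarrow> (\<exists>\<mu>. l = \<mu> \<circ> r \<and> \<not> inj \<mu>)"
proof
  assume succ: "l \<succ> r"
  then have fib: "l y = l x" if "r y = r x" for x y
    using that unfolding succ_rel_def inv_comp_def by blast
  have eq: "l = (l \<circ> inv r) \<circ> r"
    by (rule ext, simp, rule fib) (simp add: surj_f_inv_f[OF assms])
  obtain x y where "l y = l x" "r y \<noteq> r x"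
    using succ unfolding succ_rel_def inv_comp_def by blast
  then have "\<not> inj (l \<circ> inv r)"
    using fun_cong[OF eq] by (metis comp_apply injD)
  with eq show "\<exists>\<mu>. l = \<mu> \<circ> r \<and> \<not> inj \<mu>" by blast
next
  assume "\<exists>\<mu>. l = \<mu> \<circ> r \<and> \<not> inj \<mu>"
  then obtain \<mu> where l: "l = \<mu> \<circ> r" and "\<not> inj \<mu>" by blast
  then obtain a b where ab: "\<mu> a = \<mu> b" "a \<noteq> b" unfolding inj_def by blast
  obtain x y where "r x = a" "r y = b" using assms by (metis surjD)
  with l ab have "y \<in> inv_comp l x" "y \<notin> inv_comp r x" unfolding inv_comp_def by auto
  moreover have "inv_comp r x \<subseteq> inv_comp l x" for x unfolding inv_comp_def l by auto
  ultimately show "l \<succ> r" unfolding succ_rel_def by blast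
qed

lemma euclid_step_iff:
  assumes "surj l" and "surj r"
  shows "euclid_step (l, r) = Some (l', r') \<longleftrightarrow>
    (l = l' \<circ> r \<and> \<not> inj l' \<and> r' = r) \<or> (r = r' \<circ> l \<and> \<not> inj r' \<and> l' = l)"
proof -
  have excl: "\<not> (l \<succ> r \<and> r \<succ> l)" unfolding succ_rel_def by blast
  have L: "(l \<succ> r \<and> l' = as_fun (comp_inv l r)) \<longleftrightarrow> (l = l' \<circ> r \<and> \<not> inj l')"
    using succ_rel_iff_factor[OF assms(2)] as_fun_comp_inv_factor[OF assms(2)] by metis
  have R: "(r \<succ> l \<and> r' = as_fun (comp_inv r l)) \<longleftrightarrow> (r = r' \<circ> l \<and> \<not> inj r')"
    using succ_rel_iff_factor[OF assms(1)] as_fun_comp_inv_factor[OF assms(1)] by metis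
  have "euclid_step (l, r) = Some (l', r') \<longleftrightarrow>
      (l \<succ> r \<and> l' = as_fun (comp_inv l r)) \<and> r' = r
      \<or> (r \<succ> l \<and> r' = as_fun (comp_inv r l)) \<and> l' = l"
    using excl unfolding euclid_step_def by auto
  then show ?thesis using L R by blast
qed

text \<open>A continuous map of a compact space onto a Hausdorff space is closed, hence a quotient map.\<close>

lemma continuous_factor:
  fixes \<mu> r :: "'a::metric_space \<Rightarrow> 'a"
  assumes "compact (UNIV :: 'a set)" and "continuous_on UNIV r" and "surj r"
    and "continuous_on UNIV (\<mu> \<circ> r)"
  shows "continuous_on UNIV \<mu>"
  unfolding continuous_on_closed_vimage[OF closed_UNIV]
proof (intro allI impI)
  fix C :: "'a set"
  assume "closed C"
  then have "closed ((\<mu> \<circ> r) -` C)"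
    using assms(4) unfolding continuous_on_closed_vimage[OF closed_UNIV] by simp
  then have "compact ((\<mu> \<circ> r) -` C)"
    using assms(1) compact_Int_closed by fastforce
  with continuous_on_subset[OF assms(2) subset_UNIV] have "closed (r ` ((\<mu> \<circ> r) -` C))"
    by (intro compact_imp_closed compact_continuous_image)
  moreover have "r ` ((\<mu> \<circ> r) -` C) = \<mu> -` C"
    using surj_image_vimage_eq[OF assms(3), of "\<mu> -` C"] by (simp add: vimage_comp)
  ultimately show "closed (\<mu> -` C \<inter> UNIV)" by simp
qed

text \<open>The onto map \<open>r\<close> can be cancelled on the right of \<open>\<mu> \<circ> r \<circ> r = r \<circ> \<mu> \<circ> r\<close>.\<close>

lemma commuting_factor:
  assumes "surj r" and "commuting (\<mu> \<circ> r) r"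
  shows "commuting \<mu> r"
proof -
  have "\<mu> (r z) = r (\<mu> z)" for z
  proof -
    obtain y where "r y = z" using assms(1) by (metis surjD)
    then show ?thesis using assms(2) unfolding commuting_def by (metis comp_apply)
  qed
  then show ?thesis unfolding commuting_def by (simp add: fun_eq_iff)
qed

lemma commuting_sym: "commuting f g \<Longrightarrow> commuting g f"
  unfolding commuting_def by simp

lemma commuting_funpow:
  assumes "commuting u p"
  shows "commuting u (p ^^ n)"
proof (induction n)
  case 0
  then show ?case by (simp add: commuting_def fun_eq_iff)
next
  case (Suc n)
  then show ?case using assms by (simp add: commuting_def fun_eq_iff)
qed

text \<open>The right-hand side does not change when \<open>(a, n)\<close> and \<open>(b, m)\<close> are exchanged, so this gives both that words in \<open>h\<close> and \<open>\<phi>\<close>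
  commute and that they are closed under composition.\<close>

lemma funpow_words_comp:
  assumes "commuting h \<phi>"
  shows "(h ^^ a \<circ> \<phi> ^^ n) \<circ> (h ^^ b \<circ> \<phi> ^^ m) = h ^^ (a + b) \<circ> \<phi> ^^ (n + m)"
proof -
  have "commuting (\<phi> ^^ n) (h ^^ b)"
    by (intro commuting_funpow commuting_sym[OF commuting_funpow] assms)
  then show ?thesis by (simp add: commuting_def fun_eq_iff funpow_add)
qed

section \<open>Homeomorphisms\<close>

lemma is_homeo_imp_bij: "is_homeo h \<Longrightarrow> bij h"
  unfolding is_homeo_def homeomorphism_def by (metis UNIV_I bij_betw_byWitness image_subset_iff)

lemma is_homeo_id: "is_homeo id"
  unfolding is_homeo_def id_def using homeomorphism_ident by blast

lemma is_homeo_comp: "is_homeo u \<Longrightarrow> is_homeo v \<Longrightarrow> is_homeo (u \<circ> v)"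
  unfolding is_homeo_def using homeomorphism_compose by blast

lemma is_homeo_inv:
  assumes "is_homeo u"
  shows "is_homeo (inv u)"
proof -
  obtain k where k: "homeomorphism UNIV UNIV u k" using assms unfolding is_homeo_def by blast
  then have "inv u = k"
    by (intro inv_equality) (auto simp: homeomorphism_def)
  with k show ?thesis unfolding is_homeo_def using homeomorphism_sym by blast
qed

lemma is_homeo_funpow: "is_homeo h \<Longrightarrow> is_homeo (h ^^ n)"
  by (induction n) (simp_all add: is_homeo_comp is_homeo_id)

lemma is_homeo_of_bij:
  fixes f :: "'a::metric_space \<Rightarrow> 'a"
  assumes "compact (UNIV :: 'a set)" and "continuous_on UNIV f" and "surj f" and "inj f"
  shows "is_homeo f"
  unfolding is_homeo_def using homeomorphism_compact[OF assms] by blast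

lemma commuting_comp_inv:
  assumes "commuting u p" and "commuting v p" and "bij v"
  shows "commuting (u \<circ> inv v) p"
proof -
  have "inv v (p x) = p (inv v x)" for x
  proof -
    have "v (p (inv v x)) = p x"
      using assms(2,3) by (metis bij_inv_eq_iff commuting_def comp_apply)
    then show ?thesis using assms(3) by (metis bij_inv_eq_iff)
  qed
  then show ?thesis using assms(1) by (simp add: commuting_def fun_eq_iff)
qed

section \<open>Runs of the algorithm\<close>

lemma euclid_seq_induct [consumes 1, case_names start step]:
  assumes "euclid_seq f g N = Some (l, r)"
    and start: "P f g"
    and step: "\<And>i l r l' r'. euclid_seq f g i = Some (l, r) \<Longrightarrow> P l r \<Longrightarrow>
      euclid_step (l, r) = Some (l', r') \<Longrightarrow> P l' r'"
  shows "P l r"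
  using assms(1)
proof (induction N arbitrary: l r)
  case (Suc N)
  show ?case
  proof (cases N)
    case 0
    with Suc.prems start show ?thesis by simp
  next
    case (Suc i)
    with Suc.prems obtain l0 r0 where "euclid_seq f g N = Some (l0, r0)"
      and "euclid_step (l0, r0) = Some (l, r)"
      by (auto simp: bind_eq_Some_conv)
    with Suc.IH step show ?thesis by blast
  qed
qed simp

lemma euclid_defined_prefix:
  assumes "euclid_defined f g N"
  shows "\<forall>i\<in>{1..N}. euclid_defined f g i"
  using assms
proof (induction N)
  case (Suc N)
  show ?case
  proof (cases N)
    case 0
    then show ?thesis by (simp add: euclid_defined_def)
  next
    case (Suc i)
    then have "euclid_seq f g (Suc N) = Option.bind (euclid_seq f g N) euclid_step" by simp
    with Suc.prems have "euclid_defined f g N"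
      by (cases "euclid_seq f g N") (simp_all add: euclid_defined_def)
    with Suc.IH Suc.prems show ?thesis by (auto simp: le_Suc_eq)
  qed
qed simp

text \<open>The algorithm cannot resume once it has stopped, so being defined at \<open>N\<close> already includes being
  defined at all earlier indices.\<close>

lemma ex_euclid_run_iff:
  "(\<exists>N\<ge>1. (\<forall>i\<in>{1..N}. euclid_defined f g i) \<and> P (euclid_lam f g N) (euclid_rho f g N))
   \<longleftrightarrow> (\<exists>N l r. euclid_seq f g N = Some (l, r) \<and> P l r)" (is "?A \<longleftrightarrow> ?B")
proof
  assume ?A
  then obtain N where N: "N \<ge> 1" "euclid_defined f g N"
    and P: "P (euclid_lam f g N) (euclid_rho f g N)"
    by auto
  then obtain l r where "euclid_seq f g N = Some (l, r)"
    unfolding euclid_defined_def by (metis option.exhaust surj_pair)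
  with P show ?B unfolding euclid_lam_def euclid_rho_def by auto
next
  assume ?B
  then obtain N l r where N: "euclid_seq f g N = Some (l, r)" "P l r" by blast
  then have "N \<ge> 1" by (cases N) auto
  moreover have "euclid_defined f g N" using N by (simp add: euclid_defined_def)
  ultimately show ?A using N euclid_defined_prefix[of f g N]
    by (intro exI[of _ N]) (simp add: euclid_lam_def euclid_rho_def)
qed

text \<open>On a compact space this is an invariant of the algorithm: commutation descends by cancelling an
  onto map, continuity because onto maps of a compact Hausdorff space are quotient maps.\<close>

definition commuting_onto_maps :: "('a::topological_space \<Rightarrow> 'a) \<Rightarrow> ('a \<Rightarrow> 'a) \<Rightarrow> bool"
  where "commuting_onto_maps l r \<longleftrightarrow>
    surj l \<and> surj r \<and> continuous_on UNIV l \<and> continuous_on UNIV r \<and> commuting l r"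

lemma commuting_onto_maps_sym: "commuting_onto_maps l r \<Longrightarrow> commuting_onto_maps r l"
  unfolding commuting_onto_maps_def by (simp add: commuting_sym)

lemma commuting_onto_maps_factor:
  fixes \<mu> r :: "'a::metric_space \<Rightarrow> 'a"
  assumes "compact (UNIV :: 'a set)" and "commuting_onto_maps (\<mu> \<circ> r) r"
  shows "commuting_onto_maps \<mu> r"
proof -
  have "surj \<mu>"
    using assms(2) fun.set_map[of \<mu> r] unfolding commuting_onto_maps_def by auto
  then show ?thesis
    using assms commuting_factor continuous_factor unfolding commuting_onto_maps_def by blast
qed

lemma euclid_step_invariant:
  fixes l r :: "'a::metric_space \<Rightarrow> 'a"
  assumes "compact (UNIV :: 'a set)" and "commuting_onto_maps l r"
    and "euclid_step (l, r) = Some (l', r')"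
  shows "commuting_onto_maps l' r'"
proof -
  have "surj l" "surj r" using assms(2) unfolding commuting_onto_maps_def by auto
  from assms(3)[unfolded euclid_step_iff[OF this]] show ?thesis
    using assms(2) commuting_onto_maps_factor[OF assms(1)] commuting_onto_maps_sym by metis
qed

lemma euclid_seq_invariant:
  fixes f g :: "'a::metric_space \<Rightarrow> 'a"
  assumes "compact (UNIV :: 'a set)" and "commuting_onto_maps f g"
    and "euclid_seq f g N = Some (l, r)"
  shows "commuting_onto_maps l r"
  using assms(3)
proof (induction rule: euclid_seq_induct)
  case (step i l r l' r')
  then show ?case using euclid_step_invariant[OF assms(1)] by blast
qed (rule assms(2))

text \<open>Both entries of a pair are recovered from the next pair: one is unchanged and the other is the
  composite of the two new entries.\<close>

lemma euclid_seq_generates: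
  fixes f g :: "'a::metric_space \<Rightarrow> 'a"
  assumes "compact (UNIV :: 'a set)" and "commuting_onto_maps f g"
    and closed: "\<And>u v. u \<in> S \<Longrightarrow> v \<in> S \<Longrightarrow> u \<circ> v \<in> S"
    and "euclid_seq f g N = Some (l, r)" and "l \<in> S" and "r \<in> S"
  shows "f \<in> S \<and> g \<in> S"
proof -
  have "l \<in> S \<longrightarrow> r \<in> S \<longrightarrow> f \<in> S \<and> g \<in> S"
    using assms(4)
  proof (induction rule: euclid_seq_induct)
    case (step i l0 r0 l r)
    have "surj l0" "surj r0"
      using euclid_seq_invariant[OF assms(1,2) step.hyps(1)] unfolding commuting_onto_maps_def by auto
    from step.hyps(2)[unfolded euclid_step_iff[OF this]] have "l0 \<in> S \<and> r0 \<in> S"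
      if "l \<in> S" "r \<in> S"
      using closed that by metis
    with step.IH show ?case by blast
  qed simp
  then show ?thesis using assms(5,6) by blast
qed

section \<open>Subtraction of exponents\<close>

text \<open>Since \<open>u\<close> and \<open>v\<close> commute with \<open>\<phi>\<close>, the left factor \<open>u \<circ> v\<^sup>-\<^sup>1 \<circ> \<phi>\<^sup>n\<^sup>-\<^sup>m\<close> can be split
  off \<open>u \<circ> \<phi>\<^sup>n\<close>. It has the same shape, a bijection commuting with \<open>\<phi>\<close> composed with a
  power of \<open>\<phi>\<close>, so the splitting can be repeated.\<close>

lemma power_pair_factor:
  assumes "commuting u \<phi>" and "commuting v \<phi>" and "bij v" and "m \<le> n"
  shows "u \<circ> \<phi> ^^ n = (u \<circ> inv v \<circ> \<phi> ^^ (n - m)) \<circ> (v \<circ> \<phi> ^^ m)"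
proof
  fix x
  have "\<phi> ^^ (n - m) \<circ> v = v \<circ> \<phi> ^^ (n - m)"
    using commuting_funpow[OF assms(2)] unfolding commuting_def by simp
  then have "(\<phi> ^^ (n - m)) (v y) = v ((\<phi> ^^ (n - m)) y)" for y
    by (metis comp_apply)
  moreover have "(\<phi> ^^ (n - m)) ((\<phi> ^^ m) x) = (\<phi> ^^ n) x"
    using assms(4) by (metis comp_apply funpow_add le_add_diff_inverse2)
  ultimately show "(u \<circ> \<phi> ^^ n) x = ((u \<circ> inv v \<circ> \<phi> ^^ (n - m)) \<circ> (v \<circ> \<phi> ^^ m)) x"
    using assms(3) by (simp add: bij_is_inj)
qed

lemma not_inj_comp_funpow:
  fixes \<phi> :: "'a \<Rightarrow> 'a"
  assumes "\<not> inj \<phi>" and "0 < k"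
  shows "\<not> inj (w \<circ> \<phi> ^^ k)"
proof
  assume "inj (w \<circ> \<phi> ^^ k)"
  moreover have "\<phi> ^^ k = \<phi> ^^ (k - 1) \<circ> \<phi>"
    using assms(2) by (metis Suc_diff_1 funpow_Suc_right)
  ultimately have "inj \<phi>" by (metis comp_assoc inj_on_imageI2)
  with assms(1) show False by simp
qed

text \<open>The induction is on the sum of the two exponents. The set \<open>H\<close> is instantiated both by all
  homeomorphisms commuting with \<open>\<phi>\<close> and by \<open>{id}\<close>.\<close>

lemma euclid_reaches_equal_exponents:
  assumes "surj \<phi>" and "\<not> inj \<phi>"
    and bij: "\<And>u. u \<in> H \<Longrightarrow> bij u"
    and comm: "\<And>u. u \<in> H \<Longrightarrow> commuting u \<phi>"
    and quot: "\<And>u v. u \<in> H \<Longrightarrow> v \<in> H \<Longrightarrow> u \<circ> inv v \<in> H"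
    and "euclid_seq f g N = Some (u \<circ> \<phi> ^^ n, v \<circ> \<phi> ^^ m)"
    and "u \<in> H" and "v \<in> H" and "n \<ge> 1" and "m \<ge> 1"
  shows "\<exists>M w r. euclid_seq f g M = Some (w \<circ> r, r) \<and> w \<in> H \<and> surj r"
  using assms(6-10)
proof (induction "n + m" arbitrary: N n m u v rule: less_induct)
  case less
  have surj_word: "surj (w \<circ> \<phi> ^^ k)" if "w \<in> H" for w k
    using that bij assms(1) by (metis bij_is_surj comp_surj surj_fn)
  note step = euclid_step_iff[OF surj_word[OF \<open>u \<in> H\<close>] surj_word[OF \<open>v \<in> H\<close>]]
  obtain i where i: "N = Suc i" using less.prems(1) by (cases N) auto
  consider "n = m" | "m < n" | "n < m" by linarith
  then show ?case
  proof cases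
    case 1
    have "u \<circ> \<phi> ^^ n = (u \<circ> inv v) \<circ> (v \<circ> \<phi> ^^ m)"
      using power_pair_factor[of u \<phi> v m n] 1 comm bij less.prems(2,3) by simp
    then show ?thesis using less.prems quot surj_word by metis
  next
    case 2
    define w where "w = u \<circ> inv v"
    have w: "w \<in> H" using quot less.prems(2,3) by (simp add: w_def)
    have "u \<circ> \<phi> ^^ n = (w \<circ> \<phi> ^^ (n - m)) \<circ> (v \<circ> \<phi> ^^ m)"
      using power_pair_factor[of u \<phi> v m n] 2 comm bij less.prems(2,3) by (simp add: w_def)
    moreover have "\<not> inj (w \<circ> \<phi> ^^ (n - m))"
      by (intro not_inj_comp_funpow) (use 2 assms(2) in simp_all)
    ultimately have
      "euclid_step (u \<circ> \<phi> ^^ n, v \<circ> \<phi> ^^ m) = Some (w \<circ> \<phi> ^^ (n - m), v \<circ> \<phi> ^^ m)"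
      unfolding step by blast
    then have "euclid_seq f g (Suc N) = Some (w \<circ> \<phi> ^^ (n - m), v \<circ> \<phi> ^^ m)"
      using less.prems(1) by (simp add: i)
    then show ?thesis using less.hyps[of "n - m" m "Suc N" w v] 2 w less.prems by simp
  next
    case 3
    define w where "w = v \<circ> inv u"
    have w: "w \<in> H" using quot less.prems(2,3) by (simp add: w_def)
    have "v \<circ> \<phi> ^^ m = (w \<circ> \<phi> ^^ (m - n)) \<circ> (u \<circ> \<phi> ^^ n)"
      using power_pair_factor[of v \<phi> u n m] 3 comm bij less.prems(2,3) by (simp add: w_def)
    moreover have "\<not> inj (w \<circ> \<phi> ^^ (m - n))"
      by (intro not_inj_comp_funpow) (use 3 assms(2) in simp_all)
    ultimately have
      "euclid_step (u \<circ> \<phi> ^^ n, v \<circ> \<phi> ^^ m) = Some (u \<circ> \<phi> ^^ n, w \<circ> \<phi> ^^ (m - n))"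
      unfolding step by blast
    then have "euclid_seq f g (Suc N) = Some (u \<circ> \<phi> ^^ n, w \<circ> \<phi> ^^ (m - n))"
      using less.prems(1) by (simp add: i)
    then show ?thesis using less.hyps[of n "m - n" "Suc N" u w] 3 w less.prems by simp
  qed
qed

text \<open>If \<open>\<phi>\<close> were injective, \<open>f\<close> would be a continuous bijection of a compact Hausdorff space,
  hence a homeomorphism.\<close>

lemma base_map_onto_not_inj:
  fixes f \<phi> :: "'a::metric_space \<Rightarrow> 'a"
  assumes "compact (UNIV :: 'a set)" and "continuous_on UNIV f" and "surj f" and "\<not> is_homeo f"
    and "f = w \<circ> \<phi> ^^ n" and "bij w" and "n \<ge> 1"
  shows "surj \<phi>" and "\<not> inj \<phi>"
proof -
  have "\<phi> ^^ n = inv w \<circ> f"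
    using assms(5,6) by (simp add: fun_eq_iff bij_is_inj)
  then have "surj (\<phi> ^^ n)"
    using assms(3,6) comp_surj[OF assms(3), of "inv w"] by (simp add: bij_imp_bij_inv bij_is_surj)
  moreover have "\<phi> ^^ n = \<phi> \<circ> \<phi> ^^ (n - 1)"
    using assms(7) by (metis Suc_diff_1 funpow.simps(2) less_le_trans zero_less_one)
  ultimately show "surj \<phi>" by (metis comp_apply surj_def)
  show "\<not> inj \<phi>"
  proof
    assume "inj \<phi>"
    then have "inj f" using assms(5,6) by (simp add: bij_is_inj inj_compose inj_fn)
    then show False using is_homeo_of_bij assms(1-4) by blast
  qed
qed

section \<open>Characterization of kin and cousins\<close>

theorem theorem4p17:
  fixes f g :: "'a::metric_space \<Rightarrow> 'a"
  assumes "compact (UNIV :: 'a set)" and "connected (UNIV :: 'a set)"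
    and "continuous_on UNIV f" and "continuous_on UNIV g"
    and "surj f" and "surj g"
    and "\<not> is_homeo f" and "\<not> is_homeo g"
    and "f \<noteq> g"
  shows "(kin f g \<longleftrightarrow>
            commuting f g \<and>
            (\<exists>N\<ge>1. (\<forall>i\<in>{1..N}. euclid_defined f g i) \<and>
                   sv_homeo (comp_inv (euclid_lam f g N) (euclid_rho f g N))))
       \<and> (cousins f g \<longleftrightarrow>
            commuting f g \<and>
            (\<exists>N\<ge>1. (\<forall>i\<in>{1..N}. euclid_defined f g i) \<and>
                   euclid_lam f g N = euclid_rho f g N))"
proof -
  have start: "euclid_seq f g 1 = Some (f, g)" by simp
  have onto: "commuting_onto_maps f g" if "commuting f g"
    using that assms(3-6) unfolding commuting_onto_maps_def by simp
  have kin_iff: "kin f g \<longleftrightarrow> commuting f g \<and>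
      (\<exists>N l r. euclid_seq f g N = Some (l, r) \<and> sv_homeo (comp_inv l r))" (is "_ \<longleftrightarrow> ?R")
  proof
    assume "kin f g"
    then obtain \<phi> h a b n m where h: "is_homeo h" and c: "commuting h \<phi>"
      and n: "n \<ge> 1" and m: "m \<ge> 1"
      and f: "f = h ^^ a \<circ> \<phi> ^^ n" and g: "g = h ^^ b \<circ> \<phi> ^^ m"
      unfolding kin_def by blast
    have fg: "commuting f g"
      unfolding f g commuting_def funpow_words_comp[OF c] by (simp add: add.commute)
    define H where "H = {u. is_homeo u \<and> commuting u \<phi>}"
    have bij: "bij u" and comm: "commuting u \<phi>" if "u \<in> H" for u
      using that is_homeo_imp_bij unfolding H_def by auto
    have quot: "u \<circ> inv v \<in> H" if "u \<in> H" "v \<in> H" for u v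
      using that is_homeo_comp is_homeo_inv commuting_comp_inv bij unfolding H_def by blast
    have H: "h ^^ k \<in> H" for k
      unfolding H_def using is_homeo_funpow[OF h] c commuting_funpow commuting_sym by blast
    note \<phi> = base_map_onto_not_inj[OF assms(1,3,5,7) f bij[OF H] n]
    obtain M w r where M: "euclid_seq f g M = Some (w \<circ> r, r)" and "w \<in> H" "surj r"
      using euclid_reaches_equal_exponents[OF \<phi> bij comm quot start[unfolded f g] H H n m]
      unfolding f g by blast
    then have "sv_homeo (comp_inv (w \<circ> r) r)"
      unfolding sv_homeo_def
      using pointwise_singleton_factor as_fun_comp_inv_factor by (metis H_def mem_Collect_eq)
    with M fg show ?R by blast
  next
    assume R: ?R
    then obtain N l \<phi> where N: "euclid_seq f g N = Some (l, \<phi>)"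
      and sv: "sv_homeo (comp_inv l \<phi>)" by blast
    note fg = onto[OF conjunct1[OF R]]
    define h where "h = as_fun (comp_inv l \<phi>)"
    have l: "l = h \<circ> \<phi>" and h: "is_homeo h"
      using sv factor_of_pointwise_singleton unfolding sv_homeo_def h_def by auto
    have "commuting_onto_maps (h \<circ> \<phi>) \<phi>"
      using euclid_seq_invariant[OF assms(1) fg N] l by simp
    then have \<phi>: "commuting_onto_maps h \<phi>"
      using commuting_onto_maps_factor[OF assms(1)] by blast
    then have c: "commuting h \<phi>" unfolding commuting_onto_maps_def by simp
    define S where "S = {h ^^ a \<circ> \<phi> ^^ n | a n. n \<ge> 1}"
    have S: "h ^^ a \<circ> \<phi> ^^ n \<in> S" if "n \<ge> 1" for a n
      using that unfolding S_def by blast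
    have "u \<circ> v \<in> S" if uv: "u \<in> S" "v \<in> S" for u v
    proof -
      obtain a n where u: "u = h ^^ a \<circ> \<phi> ^^ n" "n \<ge> 1" using uv(1) unfolding S_def by blast
      obtain b m where v: "v = h ^^ b \<circ> \<phi> ^^ m" "m \<ge> 1" using uv(2) unfolding S_def by blast
      show ?thesis unfolding u(1) v(1) funpow_words_comp[OF c] using u(2) by (intro S) simp
    qed
    (* l is the word with a = n = 1, and \<phi> the one with a = 0, n = 1 *)
    moreover have "l \<in> S" "\<phi> \<in> S" using S[of 1 1] S[of 1 0] l by simp_all
    ultimately have "f \<in> S \<and> g \<in> S"
      using euclid_seq_generates[OF assms(1) fg _ N] by blast
    then show "kin f g"
      using h c \<phi> unfolding S_def kin_def commuting_onto_maps_def by blast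
  qed
  have cousins_iff: "cousins f g \<longleftrightarrow> commuting f g \<and>
      (\<exists>N l r. euclid_seq f g N = Some (l, r) \<and> l = r)" (is "_ \<longleftrightarrow> ?R")
  proof
    assume "cousins f g"
    then obtain \<phi> n m where n: "n \<ge> 1" and m: "m \<ge> 1"
      and f: "f = id \<circ> \<phi> ^^ n" and g: "g = id \<circ> \<phi> ^^ m"
      unfolding cousins_def by auto
    have fg: "commuting f g"
      unfolding f g commuting_def id_comp funpow_add[symmetric] by (simp add: add.commute)
    note \<phi> = base_map_onto_not_inj[OF assms(1,3,5,7) f bij_id n]
    have "\<exists>M w r. euclid_seq f g M = Some (w \<circ> r, r) \<and> w \<in> {id} \<and> surj r"
      by (rule euclid_reaches_equal_exponents[OF \<phi> _ _ _ _ _ _ n m, of _ f g 1 id id])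
        (use f g in \<open>auto simp: commuting_def\<close>)
    with fg show ?R by auto
  next
    assume R: ?R
    then obtain N \<phi> where N: "euclid_seq f g N = Some (\<phi>, \<phi>)" by blast
    note fg = onto[OF conjunct1[OF R]]
    have \<phi>: "continuous_on UNIV \<phi>"
      using euclid_seq_invariant[OF assms(1) fg N] unfolding commuting_onto_maps_def by simp
    define S where "S = {\<phi> ^^ n | n. n \<ge> 1}"
    have "u \<circ> v \<in> S" if uv: "u \<in> S" "v \<in> S" for u v
    proof -
      obtain n where u: "u = \<phi> ^^ n" "n \<ge> 1" using uv(1) unfolding S_def by blast
      obtain m where v: "v = \<phi> ^^ m" "m \<ge> 1" using uv(2) unfolding S_def by blast
      have "u \<circ> v = \<phi> ^^ (n + m)" "n + m \<ge> 1" using u v by (simp_all add: funpow_add)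
      then show ?thesis unfolding S_def by blast
    qed
    moreover have "\<phi> \<in> S" unfolding S_def by (auto intro: exI[of _ 1])
    ultimately have "f \<in> S \<and> g \<in> S"
      using euclid_seq_generates[OF assms(1) fg _ N] by blast
    then show "cousins f g" using \<phi> unfolding S_def cousins_def by blast
  qed
  show ?thesis
    unfolding ex_euclid_run_iff[of f g "\<lambda>l r. sv_homeo (comp_inv l r)"]
      ex_euclid_run_iff[of f g "\<lambda>l r. l = r"]
    using kin_iff cousins_iff by blast
qed

end
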